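(* Let $G$ be an edge-colored graph. Suppose that for each vertex $v\in V(G)$ there exist a vertex $v'\in V(G)$ and two internally vertex-disjoint PC paths $P$ and $Q$ in $G$ such that $ch(P)=[v,\alpha_1,\beta_1,v']$, $ch(Q)=[v,\alpha_2,\beta_2,v']$ and $\alpha_1\neq\alpha_2$. Then $G$ contains a PC cycle.
   Context: Graphs are finite, undirected, loopless, and have at least one vertex; parallel edges are allowed. An edge-colored graph is a graph $G$ in which each edge $e$ is assigned a color $col_G(e)$ (arbitrary; colors on different edges need not be distinct). A path or cycle in $G$ is properly colored (PC) if each pair of adjacent edges on it has distinct colors (for a cycle this includes the pair formed by the last and first edges). Two parallel edges with distinct colors form a PC cycle of length 2; all other cycles have length at least 3. The character of a PC path $P=u_1u_2\cdots u_m$ with $m\geq 2$ (so $u_1\ne u_m$) is $ch(P)=[u_1,col(u_1u_2),col(u_{m-1}u_m),u_m]$, i.e. the first end-vertex, the color of the first edge, the color of the last edge, and the last end-vertex (if $m=2$ the first and last edge coincide). Here $[u_1,c,c',u_m]$ and $[u_m,c',c,u_1]$ are regarded as the same object. Thus in the claim $P$ and $Q$ both join $v$ to $v'$, $v\neq v'$, and the colors $\alpha_1,\alpha_2$ are those of the edges of $P$ and $Q$ incident with $v$. Two paths from $v$ to $v'$ are internally vertex-disjoint if they share no vertex other than $v$ and $v'$. *)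

theory Defs
  imports Main
begin

text \<open>Finite, undirected, loopless multigraphs with colored edges. Edges are abstract objects,
  so distinct parallel edges share their set of ends but may differ in color.\<close>

record ('v, 'e, 'c) ec_graph =
  verts :: "'v set"
  edges :: "'e set"
  ends :: "'e \<Rightarrow> 'v set"
  col :: "'e \<Rightarrow> 'c"

locale edge_colored_graph =
  fixes G :: "('v, 'e, 'c) ec_graph"
  assumes finite_verts: "finite (verts G)"
    and verts_nonempty: "verts G \<noteq> {}"
    and finite_edges: "finite (edges G)"
    and ends_in_verts: "e \<in> edges G \<Longrightarrow> ends G e \<subseteq> verts G"
    and card_ends: "e \<in> edges G \<Longrightarrow> card (ends G e) = 2"

text \<open>With parallel edges a path is not determined by its vertices, so paths and cycles
  are pairs of a vertex list and an edge list.\<close>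

definition is_path :: "('v, 'e, 'c) ec_graph \<Rightarrow> 'v list \<times> 'e list \<Rightarrow> bool" where
  "is_path G P \<longleftrightarrow> (case P of (us, es) \<Rightarrow>
     length us = Suc (length es) \<and> distinct us \<and>
     set us \<subseteq> verts G \<and> set es \<subseteq> edges G \<and>
     (\<forall>i < length es. ends G (es ! i) = {us ! i, us ! Suc i}))"

definition pc_path :: "('v, 'e, 'c) ec_graph \<Rightarrow> 'v list \<times> 'e list \<Rightarrow> bool" where
  "pc_path G P \<longleftrightarrow> is_path G P \<and>
     (\<forall>i. Suc i < length (snd P) \<longrightarrow> col G (snd P ! i) \<noteq> col G (snd P ! Suc i))"

text \<open>The edge \<open>es ! i\<close> joins \<open>us ! i\<close> to its cyclic successor. Distinctness of the edges
  matters only for length 2, where it excludes traversing one edge back and forth.\<close>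

definition is_cycle :: "('v, 'e, 'c) ec_graph \<Rightarrow> 'v list \<times> 'e list \<Rightarrow> bool" where
  "is_cycle G C \<longleftrightarrow> (case C of (us, es) \<Rightarrow>
     length us = length es \<and> 2 \<le> length es \<and> distinct us \<and> distinct es \<and>
     set us \<subseteq> verts G \<and> set es \<subseteq> edges G \<and>
     (\<forall>i < length es. ends G (es ! i) = {us ! i, us ! (Suc i mod length es)}))"

definition pc_cycle :: "('v, 'e, 'c) ec_graph \<Rightarrow> 'v list \<times> 'e list \<Rightarrow> bool" where
  "pc_cycle G C \<longleftrightarrow> is_cycle G C \<and>
     (\<forall>i < length (snd C).
        col G (snd C ! i) \<noteq> col G (snd C ! (Suc i mod length (snd C))))"

text \<open>The bracket $[u,c,c',w]$, identified with $[w,c',c,u]$: an unordered pair whose members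
  are an end-vertex together with the color of the path's edge at that end.\<close>

definition bracket :: "'v \<Rightarrow> 'c \<Rightarrow> 'c \<Rightarrow> 'v \<Rightarrow> ('v \<times> 'c) set" where
  "bracket u c c' w = {(u, c), (w, c')}"

lemma bracket_eq_iff:
  "bracket u c c' w = bracket x d d' y \<longleftrightarrow>
     (u = x \<and> c = d \<and> c' = d' \<and> w = y) \<or> (u = y \<and> c = d' \<and> c' = d \<and> w = x)"
  by (auto simp: bracket_def doubleton_eq_iff)

text \<open>Meaningful only for paths with at least two vertices.\<close>

definition ch :: "('v, 'e, 'c) ec_graph \<Rightarrow> 'v list \<times> 'e list \<Rightarrow> ('v \<times> 'c) set" where
  "ch G P = (case P of (us, es) \<Rightarrow>
     bracket (hd us) (col G (hd es)) (col G (last es)) (last us))"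

text \<open>Intended for two paths that both have ends \<open>v\<close> and \<open>v'\<close>.\<close>

definition internally_disjoint ::
  "'v \<Rightarrow> 'v \<Rightarrow> 'v list \<times> 'e list \<Rightarrow> 'v list \<times> 'e list \<Rightarrow> bool" where
  "internally_disjoint v v' P Q \<longleftrightarrow> set (fst P) \<inter> set (fst Q) \<subseteq> {v, v'}"

end

theory Submission
  imports Defs
begin

text \<open>
  Without a PC cycle, PC paths to which one cannot return can be prolonged forever, which a finite
  graph does not allow.  Call a PC path \<open>p\<close> a \<^emph>\<open>trap\<close> if no PC path
  that continues \<open>p\<close> beyond its end (leaving with a color other than the last one of \<open>p\<close>) ever
  comes back to a vertex of \<open>p\<close>.  Two facts carry the proof.

  \<^item> Traps compose (lemma \<open>trap_append\<close>): if a trap \<open>q\<close> continues a trap \<open>p\<close>, then \<open>p @ q\<close> is a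
    trap.  A continuation \<open>r\<close> of \<open>p @ q\<close> misses \<open>q\<close> because \<open>q\<close> is a trap, so \<open>q @ r\<close> is a PC path
    that continues \<open>p\<close>, and it misses \<open>p\<close> because \<open>p\<close> is a trap.

  \<^item> If there is no PC cycle, the two paths \<open>P\<close> and \<open>Q\<close> of the hypothesis are traps (lemma
    \<open>lens_trap\<close>).  Their last colors agree, as otherwise their union is a PC cycle.  If a
    continuation \<open>r\<close> of \<open>P\<close> returns to the union at a vertex \<open>x\<close>, follow it up to its first
    return; here \<open>x \<noteq> v'\<close>.  The color with which \<open>r\<close> arrives differs from the color of one of the two edges of the
    union at \<open>x\<close>; going on from \<open>x\<close> along this edge leads around to \<open>v'\<close> without a color
    conflict, since \<open>v'\<close> is the only vertex of the union where consecutive colors agree.  This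
    closes a PC cycle, because \<open>r\<close> leaves \<open>v'\<close> with a color other than the common last one.

  Now suppose that there is no PC cycle.  The hypothesis at any vertex provides a trap, and no path
  has more edges than there are vertices, so there is a longest trap \<open>p\<close>.  The first colors of the two
  paths that the hypothesis provides at the end of \<open>p\<close> differ, so one of them is not the last color
  of \<open>p\<close>.  That path continues \<open>p\<close>, and by composition it yields a longer trap, a contradiction.
\<close>

section \<open>Paths as lists of darts\<close>

text \<open>A dart is an edge traversed in a given direction.  When a path is the list of its darts,
  concatenation is list append, and the conditions at a junction concern two darts only.\<close>

datatype ('v, 'e) dart = Dart (src: 'v) (via: 'e) (dst: 'v)

definition flip :: "('v, 'e) dart \<Rightarrow> ('v, 'e) dart" where
  "flip d = Dart (dst d) (via d) (src d)"

lemma flip_sel [simp]: "src (flip d) = dst d" "dst (flip d) = src d" "via (flip d) = via d"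
  by (simp_all add: flip_def)

definition reversed :: "('v, 'e) dart list \<Rightarrow> ('v, 'e) dart list" where
  "reversed ds = rev (map flip ds)"

lemma reversed_simps [simp]:
  "reversed ds = [] \<longleftrightarrow> ds = []"
  "ds \<noteq> [] \<Longrightarrow> hd (reversed ds) = flip (last ds)"
  "ds \<noteq> [] \<Longrightarrow> last (reversed ds) = flip (hd ds)"
  "set (reversed ds) = flip ` set ds"
  "map dst (reversed ds) = rev (map src ds)"
  by (simp_all add: reversed_def hd_rev last_rev hd_map last_map rev_map)

definition is_dart :: "('v, 'e, 'c) ec_graph \<Rightarrow> ('v, 'e) dart \<Rightarrow> bool" where
  "is_dart G d \<longleftrightarrow> via d \<in> edges G \<and> ends G (via d) = {src d, dst d}"

definition follows :: "('v, 'e, 'c) ec_graph \<Rightarrow> ('v, 'e) dart \<Rightarrow> ('v, 'e) dart \<Rightarrow> bool" where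
  "follows G d d' \<longleftrightarrow> dst d = src d' \<and> col G (via d) \<noteq> col G (via d')"

definition vertices :: "('v, 'e) dart list \<Rightarrow> 'v set" where
  "vertices ds = insert (src (hd ds)) (dst ` set ds)"

definition pc_dpath :: "('v, 'e, 'c) ec_graph \<Rightarrow> ('v, 'e) dart list \<Rightarrow> bool" where
  "pc_dpath G ds \<longleftrightarrow> ds \<noteq> [] \<and> (\<forall>d \<in> set ds. is_dart G d) \<and> successively (follows G) ds \<and>
     distinct (src (hd ds) # map dst ds)"

definition pc_dcycle :: "('v, 'e, 'c) ec_graph \<Rightarrow> ('v, 'e) dart list \<Rightarrow> bool" where
  "pc_dcycle G ds \<longleftrightarrow> ds \<noteq> [] \<and> (\<forall>d \<in> set ds. is_dart G d) \<and> successively (follows G) ds \<and>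
     follows G (last ds) (hd ds) \<and> distinct (map dst ds)"

text \<open>Both sides list the vertices of the path in the order of traversal.\<close>

lemma src_snoc_dst:
  assumes "successively (follows G) ds" "ds \<noteq> []"
  shows "map src ds @ [dst (last ds)] = src (hd ds) # map dst ds"
  using assms
proof (induction ds rule: induct_list012)
  case (3 d d' ds)
  then show ?case by (simp add: follows_def)
qed simp_all

lemma pc_dpath_append:
  assumes "pc_dpath G p" "pc_dpath G q" "follows G (last p) (hd q)"
    and "dst ` set q \<inter> vertices p = {}"
  shows "pc_dpath G (p @ q)"
  using assms by (auto simp: pc_dpath_def successively_append_iff vertices_def)

lemma pc_dpath_appendD1:
  assumes "pc_dpath G (p @ q)" "p \<noteq> []"
  shows "pc_dpath G p"
  using assms by (auto simp: pc_dpath_def successively_append_iff)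

lemma pc_dpath_appendD2:
  assumes "pc_dpath G (p @ q)" "q \<noteq> []"
  shows "pc_dpath G q"
proof (cases "p = []")
  case False
  then have "src (hd q) = dst (last p)" "last p \<in> set p"
    using assms by (auto simp: pc_dpath_def successively_append_iff follows_def)
  then have "src (hd q) \<in> dst ` set p" by auto
  then show ?thesis
    using assms by (auto simp: pc_dpath_def successively_append_iff)
qed (use assms in simp)

lemma pc_dpath_reversed:
  assumes "pc_dpath G p"
  shows "pc_dpath G (reversed p)"
proof -
  have "distinct (map src p @ [dst (last p)])"
    using src_snoc_dst[of G p] assms by (simp add: pc_dpath_def)
  then have "distinct (src (hd (reversed p)) # map dst (reversed p))"
    using assms by (simp add: pc_dpath_def)
  moreover have "successively (\<lambda>d d'. follows G (flip d') (flip d)) p"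
    using assms by (auto simp: pc_dpath_def follows_def elim: successively_mono)
  moreover have "\<forall>d \<in> set (reversed p). is_dart G d"
    using assms by (auto simp: pc_dpath_def is_dart_def)
  ultimately show ?thesis
    using assms by (simp add: pc_dpath_def reversed_def successively_map)
qed

lemma vertices_conv_src:
  assumes "pc_dpath G p"
  shows "vertices p = insert (dst (last p)) (src ` set p)"
  using arg_cong[OF src_snoc_dst[of G p], of set] assms by (simp add: pc_dpath_def vertices_def)

lemma vertices_reversed:
  assumes "pc_dpath G p"
  shows "vertices (reversed p) = vertices p"
  using assms vertices_conv_src[OF assms]
  by (simp add: vertices_def[of "reversed p"] pc_dpath_def image_image)

lemma pc_dcycle_append:
  assumes "pc_dpath G p" "pc_dpath G q"
    and "follows G (last p) (hd q)" "follows G (last q) (hd p)"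
    and "dst ` set p \<inter> dst ` set q = {}"
  shows "pc_dcycle G (p @ q)"
  using assms by (auto simp: pc_dpath_def pc_dcycle_def successively_append_iff)

section \<open>Translation to vertex and edge lists\<close>

text \<open>Equal edges at positions \<open>i \<noteq> j\<close> would have the same two ends; as the vertices are distinct,
  this is possible only in a cycle of length 2, whose two edges differ in color.\<close>

lemma pc_dcycle_imp_pc_cycle:
  assumes "edge_colored_graph G" "pc_dcycle G ds"
  shows "\<exists>C. pc_cycle G C"
proof -
  interpret edge_colored_graph G by fact
  let ?n = "length ds"
  have ne: "ds \<noteq> []" using assms(2) by (simp add: pc_dcycle_def)
  have dart: "is_dart G (ds ! i)" if "i < ?n" for i
    using assms(2) that by (simp add: pc_dcycle_def)
  have fol: "follows G (ds ! i) (ds ! (Suc i mod ?n))" if "i < ?n" for i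
  proof (cases "Suc i = ?n")
    case True
    then have "ds ! i = last ds" "ds ! (Suc i mod ?n) = hd ds"
      using ne by (auto simp: last_conv_nth hd_conv_nth simp flip: True)
    then show ?thesis using assms(2) by (simp add: pc_dcycle_def)
  next
    case False
    then show ?thesis using assms(2) that
      by (auto simp: pc_dcycle_def successively_conv_nth)
  qed
  have len: "2 \<le> ?n"
  proof (rule ccontr)
    assume "\<not> 2 \<le> ?n"
    then have "?n = 1" using ne by (cases "?n") auto
    with fol[of 0] show False by (simp add: follows_def)
  qed
  have rot: "map src ds = last (map dst ds) # butlast (map dst ds)"
  proof -
    have "map src ds @ [dst (last ds)] = src (hd ds) # map dst ds"
      using src_snoc_dst assms(2) by (auto simp: pc_dcycle_def)
    then have "map src ds = butlast (src (hd ds) # map dst ds)"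
      by (metis butlast_snoc)
    moreover have "src (hd ds) = dst (last ds)"
      using assms(2) by (simp add: pc_dcycle_def follows_def)
    ultimately show ?thesis using ne by (simp add: last_map)
  qed
  have "distinct (map dst ds)" using assms(2) by (simp add: pc_dcycle_def)
  then have dsrc: "distinct (map src ds)"
    unfolding rot using ne distinct_append[of "butlast (map dst ds)" "[last (map dst ds)]"]
    by (simp add: distinct_butlast)
  have ends: "ends G (via (ds ! i)) = {src (ds ! i), src (ds ! (Suc i mod ?n))}" if "i < ?n" for i
    using dart[OF that] fol[OF that] by (simp add: is_dart_def follows_def)
  have src_eq: "i = j" if "src (ds ! i) = src (ds ! j)" "i < ?n" "j < ?n" for i j
    using dsrc that by (metis distinct_conv_nth length_map nth_map)
  have dvia: "distinct (map via ds)"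
    unfolding distinct_conv_nth
  proof (intro allI impI)
    fix i j assume *: "i < length (map via ds)" "j < length (map via ds)" "i \<noteq> j"
    show "map via ds ! i \<noteq> map via ds ! j"
    proof
      assume eq: "map via ds ! i = map via ds ! j"
      from * have i: "i < ?n" and j: "j < ?n" by auto
      have m: "Suc i mod ?n < ?n" "Suc j mod ?n < ?n" using ne by simp_all
      have "ends G (via (ds ! i)) = ends G (via (ds ! j))" using eq i j by simp
      then have "src (ds ! (Suc i mod ?n)) = src (ds ! j)"
        unfolding ends[OF i] ends[OF j] doubleton_eq_iff
        using src_eq[OF _ i j] *(3) by blast
      then have "j = Suc i mod ?n"
        using src_eq m i j by metis
      then show False using fol[OF i] eq i j by (simp add: follows_def)
    qed
  qed
  have "set (map src ds) \<subseteq> verts G"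
    using assms(2) ends_in_verts by (fastforce simp: pc_dcycle_def is_dart_def)
  moreover have "set (map via ds) \<subseteq> edges G"
    using assms(2) by (auto simp: pc_dcycle_def is_dart_def)
  moreover have "Suc i mod ?n < ?n" for i using ne by simp
  ultimately have "pc_cycle G (map src ds, map via ds)"
    using len dsrc dvia ends fol by (auto simp: pc_cycle_def is_cycle_def follows_def)
  then show ?thesis ..
qed

text \<open>Since a bracket is unordered, the path may have to be reversed in order to start at \<open>v\<close>.\<close>

lemma pc_path_imp_pc_dpath:
  assumes "pc_path G P" "2 \<le> length (fst P)" "ch G P = bracket v \<alpha> \<beta> v'"
  shows "\<exists>p. pc_dpath G p \<and> src (hd p) = v \<and> dst (last p) = v' \<and> vertices p = set (fst P) \<and>
    col G (via (hd p)) = \<alpha> \<and> col G (via (last p)) = \<beta>"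
proof -
  obtain us es where P: "P = (us, es)" by (cases P)
  define p where "p = map (\<lambda>i. Dart (us ! i) (es ! i) (us ! Suc i)) [0..<length es]"
  have len: "length us = Suc (length es)" and ne: "es \<noteq> []"
    using assms(1,2) P by (auto simp: pc_path_def is_path_def)
  have hd_p: "hd p = Dart (hd us) (hd es) (us ! 1)"
    and last_p: "last p = Dart (us ! (length es - 1)) (last es) (last us)"
    using ne len by (auto simp: p_def hd_map last_map hd_conv_nth last_conv_nth
        simp flip: length_greater_0_conv)
  have dst_p: "map dst p = tl us"
    using len by (intro nth_equalityI) (auto simp: p_def nth_tl)
  have us: "src (hd p) # map dst p = us"
    using len by (cases us) (auto simp: dst_p hd_p)
  have "successively (follows G) p"
    using assms(1) P
    by (auto simp: p_def successively_conv_nth pc_path_def follows_def)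
  moreover have "\<forall>d \<in> set p. is_dart G d"
    using assms(1) P by (auto simp: p_def pc_path_def is_path_def is_dart_def)
  ultimately have p: "pc_dpath G p"
    using assms(1) P us ne by (auto simp: pc_dpath_def p_def pc_path_def is_path_def)
  have vp: "vertices p = set us"
    using arg_cong[OF us, of set] by (simp add: vertices_def)
  have "p \<noteq> []" using p by (simp add: pc_dpath_def)
  have "bracket (hd us) (col G (hd es)) (col G (last es)) (last us) = bracket v \<alpha> \<beta> v'"
    using assms(3) by (simp add: ch_def P)
  then consider
    "hd us = v" "col G (hd es) = \<alpha>" "col G (last es) = \<beta>" "last us = v'" |
    "hd us = v'" "col G (hd es) = \<beta>" "col G (last es) = \<alpha>" "last us = v"
    unfolding bracket_eq_iff by blast
  then show ?thesis
  proof cases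
    case 1
    then show ?thesis using p vp hd_p last_p P by (intro exI[of _ p]) auto
  next
    case 2
    then show ?thesis
      using pc_dpath_reversed[OF p] vertices_reversed[OF p] vp hd_p last_p P \<open>p \<noteq> []\<close>
      by (intro exI[of _ "reversed p"]) auto
  qed
qed

section \<open>Traps\<close>

lemma disjoint_if_subset_avoids: "A \<inter> V \<subseteq> {x} \<Longrightarrow> B \<subseteq> V \<Longrightarrow> x \<notin> B \<Longrightarrow> A \<inter> B = {}"
  by blast

lemma disjoint_if_meet_in_doubleton:
  "V \<inter> W \<subseteq> {s, t} \<Longrightarrow> A \<subseteq> W \<Longrightarrow> B \<subseteq> V \<Longrightarrow> s \<notin> A \<Longrightarrow> t \<notin> B \<Longrightarrow> A \<inter> B = {}"
  by blast

definition trap :: "('v, 'e, 'c) ec_graph \<Rightarrow> ('v, 'e) dart list \<Rightarrow> bool" where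
  "trap G p \<longleftrightarrow> pc_dpath G p \<and>
     (\<forall>r. pc_dpath G r \<and> follows G (last p) (hd r) \<longrightarrow> dst ` set r \<inter> vertices p = {})"

lemma trap_append:
  assumes "trap G p" "trap G q" "follows G (last p) (hd q)"
  shows "trap G (p @ q)"
proof -
  have p: "pc_dpath G p" and q: "pc_dpath G q"
    using assms by (auto simp: trap_def)
  have ne: "p \<noteq> []" "q \<noteq> []" using p q by (auto simp: pc_dpath_def)
  have "dst ` set r \<inter> vertices (p @ q) = {}"
    if r: "pc_dpath G r" and fol: "follows G (last (p @ q)) (hd r)" for r
  proof -
    have rq: "dst ` set r \<inter> vertices q = {}"
      using assms(2) r fol ne by (simp add: trap_def)
    have "pc_dpath G (q @ r)"
      using pc_dpath_append[OF q r _ rq] fol ne by simp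
    then have "dst ` set (q @ r) \<inter> vertices p = {}"
      using assms(1,3) ne unfolding trap_def by (metis hd_append2)
    then show ?thesis using rq ne by (auto simp: vertices_def)
  qed
  moreover have "pc_dpath G (p @ q)"
    using pc_dpath_append[OF p q] assms q by (simp add: trap_def)
  ultimately show ?thesis by (simp add: trap_def)
qed

text \<open>A lens is the configuration of the theorem with equal colors at the far end: a cycle whose
  only conflict of consecutive colors is there.\<close>

definition lens :: "('v, 'e, 'c) ec_graph \<Rightarrow> ('v, 'e) dart list \<Rightarrow> ('v, 'e) dart list \<Rightarrow> bool" where
  "lens G p q \<longleftrightarrow> pc_dpath G p \<and> pc_dpath G q \<and>
     src (hd p) = src (hd q) \<and> dst (last p) = dst (last q) \<and>
     vertices p \<inter> vertices q \<subseteq> {src (hd p), dst (last p)} \<and>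
     col G (via (hd p)) \<noteq> col G (via (hd q)) \<and>
     col G (via (last p)) = col G (via (last q))"

lemma lens_sym: "lens G p q \<Longrightarrow> lens G q p"
  by (auto simp: lens_def)

text \<open>The path \<open>r\<close> leaves the far end of the lens and first returns to it at a vertex \<open>x\<close> of the
  side \<open>p\<close>.  From \<open>x\<close> the cycle closes either forward along \<open>p\<close> or backward along \<open>p\<close> and then
  along \<open>q\<close>.\<close>

lemma lens_return_imp_pc_dcycle:
  assumes lens: "lens G p q" and r: "pc_dpath G r" and fol: "follows G (last p) (hd r)"
    and x: "dst (last r) \<in> vertices p"
    and first: "dst ` set r \<inter> (vertices p \<union> vertices q) \<subseteq> {dst (last r)}"
  shows "\<exists>ds. pc_dcycle G ds"
proof -
  let ?x = "dst (last r)"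
  have p: "pc_dpath G p" and q: "pc_dpath G q" and ne: "p \<noteq> []" "q \<noteq> []" "r \<noteq> []"
    using lens r by (auto simp: lens_def pc_dpath_def)
  have folq: "follows G (last q) (hd r)"
    using fol lens by (simp add: lens_def follows_def)
  have "?x \<in> dst ` set r" "src (hd r) \<notin> dst ` set r"
    using r by (auto simp: pc_dpath_def)
  then have "?x \<noteq> dst (last p)"
    using fol by (metis follows_def)
  with x obtain f where f: "f \<in> set p" "src f = ?x"
    using vertices_conv_src[OF p] by auto
  then obtain a b where ab: "p = a @ f # b" by (meson split_list)
  have b: "pc_dpath G (f # b)" using pc_dpath_appendD2[of G a "f # b"] p ab by simp
  have "src (hd q) \<notin> dst ` set q" using q by (auto simp: pc_dpath_def)
  have miss: "dst ` set r \<inter> B = {}" if "?x \<notin> B" "B \<subseteq> vertices p \<union> vertices q" for B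
    using disjoint_if_subset_avoids[OF first that(2,1)] .
  show ?thesis
  proof (cases "col G (via (last r)) = col G (via f)")
    case False
    have "?x \<notin> dst ` set (f # b)" using b f by (auto simp: pc_dpath_def)
    moreover have "dst ` set (f # b) \<subseteq> vertices p" using ab by (auto simp: vertices_def)
    ultimately have "dst ` set r \<inter> dst ` set (f # b) = {}" by (intro miss) auto
    moreover have "follows G (last (f # b)) (hd r)" using fol ab by simp
    ultimately show ?thesis
      using pc_dcycle_append[OF r b] False f by (auto simp: follows_def)
  next
    case True
    \<comment> \<open>The other edge of the lens at \<open>x\<close> has another color, so \<open>r\<close> can turn into it: this is the
      edge of \<open>p\<close> before \<open>x\<close> or, if \<open>x\<close> is the start of the lens, the first edge of \<open>q\<close>.\<close>
    show ?thesis
    proof (cases "a = []")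
      case True
      then have "follows G (last r) (hd q)"
        using \<open>col G (via (last r)) = col G (via f)\<close> lens ab f by (auto simp: lens_def follows_def)
      moreover have "?x \<notin> dst ` set q"
        using True ab f lens \<open>src (hd q) \<notin> dst ` set q\<close> by (auto simp: lens_def)
      then have "dst ` set r \<inter> dst ` set q = {}" by (intro miss) (auto simp: vertices_def)
      ultimately show ?thesis using pc_dcycle_append[OF r q] folq by blast
    next
      case False
      have a: "pc_dpath G a" using pc_dpath_appendD1 p ab False by blast
      have af: "follows G (last a) f"
        using p ab False by (auto simp: pc_dpath_def successively_append_iff)
      have "distinct (map src p @ [dst (last p)])"
        using src_snoc_dst[of G p] p by (simp add: pc_dpath_def)
      then have sa: "?x \<notin> src ` set a" "dst (last p) \<notin> src ` set a"
        using ab f by (auto simp: image_iff)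
      have "vertices a \<subseteq> vertices p"
        using ab False by (auto simp: vertices_def)
      moreover have va: "vertices a = insert ?x (src ` set a)"
        using vertices_conv_src[OF a] af f by (simp add: follows_def)
      ultimately have sap: "src ` set a \<subseteq> vertices p" by blast
      have src_q: "src (hd q) = src (hd p)" "dst ` set q \<subseteq> vertices q"
        using lens by (auto simp: lens_def vertices_def)
      have start: "src (hd p) \<notin> dst ` set q"
        using \<open>src (hd q) \<notin> dst ` set q\<close> src_q(1) by simp
      have disj: "vertices p \<inter> vertices q \<subseteq> {src (hd p), dst (last p)}"
        using lens unfolding lens_def by blast
      have aq: "dst ` set q \<inter> src ` set a = {}"
        by (rule disjoint_if_meet_in_doubleton[OF disj src_q(2) sap start sa(2)])
      have xq: "?x \<notin> dst ` set q"
      proof -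
        have "?x \<noteq> src (hd p)"
        proof
          assume "?x = src (hd p)"
          with ab False have "?x \<in> src ` set a" by simp
          with sa show False by simp
        qed
        then have "?x \<notin> vertices q" using x \<open>?x \<noteq> dst (last p)\<close> disj by blast
        then show ?thesis using src_q(2) by (rule contra_subsetD[rotated])
      qed
      let ?s = "reversed a @ q"
      have s: "pc_dpath G ?s"
      proof (rule pc_dpath_append[OF pc_dpath_reversed[OF a] q])
        show "follows G (last (reversed a)) (hd q)"
          using lens ab False by (simp add: lens_def follows_def)
        show "dst ` set q \<inter> vertices (reversed a) = {}"
          unfolding vertices_reversed[OF a] va using aq xq by simp
      qed
      have "follows G (last r) (hd ?s)"
        using True False af f by (auto simp: follows_def)
      moreover have "follows G (last ?s) (hd r)" using folq ne by simp
      moreover have "dst ` set r \<inter> dst ` set ?s = {}"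
      proof -
        have "dst ` set ?s = src ` set a \<union> dst ` set q" by (simp add: image_Un image_image)
        then show ?thesis using sa(1) xq sap src_q(2) by (intro miss) auto
      qed
      ultimately show ?thesis using pc_dcycle_append[OF r s] by blast
    qed
  qed
qed

lemma lens_trap:
  assumes lens: "lens G p q" and no_cycle: "\<nexists>ds. pc_dcycle G ds"
  shows "trap G p"
proof (rule ccontr)
  assume "\<not> trap G p"
  then obtain r where r: "pc_dpath G r" and fol: "follows G (last p) (hd r)"
    and "dst ` set r \<inter> vertices p \<noteq> {}"
    using lens by (auto simp: trap_def lens_def)
  then have "\<exists>d \<in> set r. dst d \<in> vertices p \<union> vertices q" by blast
  \<comment> \<open>Cutting \<open>r\<close> at its first return, to either side, keeps the rest of it off the lens.\<close>
  from split_list_first_prop[OF this] obtain r1 d r2 where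
    split: "r = (r1 @ [d]) @ r2" "dst d \<in> vertices p \<union> vertices q"
    "\<forall>d' \<in> set r1. dst d' \<notin> vertices p \<union> vertices q"
    by auto
  let ?r = "r1 @ [d]"
  have r': "pc_dpath G ?r" using pc_dpath_appendD1 r split(1) by blast
  have fol': "follows G (last p) (hd ?r)" using fol split(1) by (cases r1) auto
  then have folq': "follows G (last q) (hd ?r)" using lens by (simp add: lens_def follows_def)
  have first: "dst ` set ?r \<inter> (vertices p \<union> vertices q) \<subseteq> {dst (last ?r)}"
    using split(3) by auto
  consider "dst (last ?r) \<in> vertices p" | "dst (last ?r) \<in> vertices q" using split(2) by auto
  then show False
  proof cases
    case 1
    then show False using lens_return_imp_pc_dcycle[OF lens r' fol' _ first] no_cycle by blast
  next
    case 2
    then show False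
      using lens_return_imp_pc_dcycle[OF lens_sym[OF lens] r' folq'] first no_cycle
      by (simp add: Un_commute)
  qed
qed

text \<open>Two sides whose colors at the far end differ would together form a PC cycle.\<close>

lemma disjoint_pc_dpaths_imp_lens:
  assumes "pc_dpath G p" "pc_dpath G q"
    and "src (hd p) = src (hd q)" "dst (last p) = dst (last q)"
    and disj: "vertices p \<inter> vertices q \<subseteq> {src (hd p), dst (last p)}"
    and "col G (via (hd p)) \<noteq> col G (via (hd q))" and no_cycle: "\<nexists>ds. pc_dcycle G ds"
  shows "lens G p q"
proof (rule ccontr)
  assume "\<not> lens G p q"
  then have neq: "col G (via (last p)) \<noteq> col G (via (last q))"
    using assms by (auto simp: lens_def)
  have ne: "p \<noteq> []" "q \<noteq> []" using assms by (auto simp: pc_dpath_def)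
  have "distinct (map src q @ [dst (last q)])"
    using src_snoc_dst[of G q] assms(2) by (simp add: pc_dpath_def)
  then have "dst (last p) \<notin> src ` set q" using assms(4) by auto
  moreover have "src (hd p) \<notin> dst ` set p" using assms(1) by (auto simp: pc_dpath_def)
  moreover have "src ` set q \<subseteq> vertices q" using vertices_conv_src[OF assms(2)] by auto
  moreover have "dst ` set p \<subseteq> vertices p" by (auto simp: vertices_def)
  ultimately have "dst ` set p \<inter> src ` set q = {}"
    using disj by (intro disjoint_if_meet_in_doubleton[of "vertices q" "vertices p"])
      (simp_all only: Int_commute)
  then have "pc_dcycle G (p @ reversed q)"
    using assms neq ne
    by (intro pc_dcycle_append pc_dpath_reversed) (auto simp: follows_def image_image)
  with no_cycle show False by blast
qed

section \<open>A longest trap can be extended\<close>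

lemma pc_dpath_in_verts:
  assumes "edge_colored_graph G" "pc_dpath G p"
  shows "dst ` set p \<subseteq> verts G" "length p \<le> card (verts G)"
proof -
  interpret edge_colored_graph G by fact
  show sub: "dst ` set p \<subseteq> verts G"
    using assms(2) ends_in_verts by (fastforce simp: pc_dpath_def is_dart_def)
  have "length p = card (dst ` set p)"
    using assms(2) distinct_card[of "map dst p"] by (simp add: pc_dpath_def)
  then show "length p \<le> card (verts G)"
    using card_mono[OF finite_verts sub] by simp
qed

theorem theorem4:
  fixes G :: "('v, 'e, 'c) ec_graph"
  assumes "edge_colored_graph G"
    and "\<forall>v \<in> verts G. \<exists>v' \<in> verts G. \<exists>P Q \<alpha>\<^sub>1 \<alpha>\<^sub>2 \<beta>\<^sub>1 \<beta>\<^sub>2.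
           pc_path G P \<and> 2 \<le> length (fst P) \<and>
           pc_path G Q \<and> 2 \<le> length (fst Q) \<and>
           internally_disjoint v v' P Q \<and>
           ch G P = bracket v \<alpha>\<^sub>1 \<beta>\<^sub>1 v' \<and>
           ch G Q = bracket v \<alpha>\<^sub>2 \<beta>\<^sub>2 v' \<and>
           \<alpha>\<^sub>1 \<noteq> \<alpha>\<^sub>2"
  shows "\<exists>C. pc_cycle G C"
proof (rule ccontr)
  assume "\<nexists>C. pc_cycle G C"
  then have no_cycle: "\<nexists>ds. pc_dcycle G ds"
    using pc_dcycle_imp_pc_cycle[OF assms(1)] by blast
  have two_traps: "\<exists>p q. trap G p \<and> trap G q \<and> src (hd p) = v \<and> src (hd q) = v \<and>
      col G (via (hd p)) \<noteq> col G (via (hd q))" if v: "v \<in> verts G" for v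
  proof -
    obtain v' P Q \<alpha>1 \<alpha>2 \<beta>1 \<beta>2 where PQ:
      "pc_path G P" "2 \<le> length (fst P)" "pc_path G Q" "2 \<le> length (fst Q)"
      "internally_disjoint v v' P Q" "ch G P = bracket v \<alpha>1 \<beta>1 v'"
      "ch G Q = bracket v \<alpha>2 \<beta>2 v'" "\<alpha>1 \<noteq> \<alpha>2"
      using bspec[OF assms(2) v] by blast
    obtain p where p: "pc_dpath G p" "src (hd p) = v" "dst (last p) = v'"
      "vertices p = set (fst P)" "col G (via (hd p)) = \<alpha>1"
      using pc_path_imp_pc_dpath[OF PQ(1,2,6)] by blast
    obtain q where q: "pc_dpath G q" "src (hd q) = v" "dst (last q) = v'"
      "vertices q = set (fst Q)" "col G (via (hd q)) = \<alpha>2"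
      using pc_path_imp_pc_dpath[OF PQ(3,4,7)] by blast
    have "lens G p q"
      using disjoint_pc_dpaths_imp_lens[OF p(1) q(1)] no_cycle p q PQ(5,8)
      by (simp add: internally_disjoint_def)
    then have "trap G p" "trap G q" using lens_trap lens_sym no_cycle by blast+
    then show ?thesis using p q PQ(8) by blast
  qed
  obtain p0 where "trap G p0"
    using two_traps edge_colored_graph.verts_nonempty[OF assms(1)] by blast
  moreover have "\<forall>p. trap G p \<longrightarrow> length p < Suc (card (verts G))"
    using pc_dpath_in_verts[OF assms(1)] by (simp add: trap_def less_Suc_eq_le)
  ultimately obtain p where p: "trap G p" and longest: "\<And>p'. trap G p' \<Longrightarrow> length p' \<le> length p"
    using ex_has_greatest_nat[of "trap G" p0 length] by blast
  have path: "pc_dpath G p" using p by (simp add: trap_def)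
  have "dst (last p) \<in> verts G"
    using pc_dpath_in_verts(1)[OF assms(1) path] path by (auto simp: pc_dpath_def)
  then obtain q where q: "trap G q" and "follows G (last p) (hd q)"
    using two_traps[of "dst (last p)"] by (metis follows_def)
  with p have "trap G (p @ q)" by (intro trap_append)
  from longest[OF this] q show False by (simp add: trap_def pc_dpath_def)
qed

end
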